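(* Let $X$ be a real Banach space and let $I_0\in\mathcal{I}$ be a closed non-degenerate interval in $\mathbb{R}^m$. Let $f:I_0\to X$ be a function and let $F:\mathcal{I}_{I_0}\to X$ be a Dunford-function. Then $f$ is Henstock-Kurzweil integrable on $I_0$ with the primitive $F$ if and only if both of the following hold: (1) for each $\varepsilon>0$ there exists a gauge $\delta_\varepsilon$ on $(I_0)^{o}$ such that for each $\delta_\varepsilon$-fine $\mathcal{HK}$-partition $\pi$ in $(I_0)^{o}$, $$\Big\|\sum_{(t,I)\in\pi}\big(f(t)|I|-F(I)\big)\Big\|<\varepsilon;$$ (2) $F$ has $\mathcal{HK}$-negligible variation over $Z=I_0\setminus(I_0)^{o}$.
   Context: $\mathbb{R}^m$ carries the maximum norm; $B_m(t,r)$ is the open ball with center $t$ and radius $r>0$; $|A|$ is the Lebesgue measure of $A$; $E^{o}$ is the interior of $E$; $\mathbb{1}_A$ is the characteristic function of $A$. Intervals. A closed non-degenerate interval in $\mathbb{R}^m$ is a set $\prod_{j=1}^m[a_j,b_j]$ with $-\infty<a_j<b_j<+\infty$ for all $j$. $\mathcal{I}$ is the family of all of them, and $\mathcal{I}_E$ is the family of those contained in $E$. Intervals $I,J$ are non-overlapping if $I^{o}\cap J^{o}=\emptyset$. A function $F:\mathcal{I}_E\to X$ is an additive interval function if $F(I\cup J)=F(I)+F(J)$ whenever $I,J\in\mathcal{I}_E$ are non-overlapping and $I\cup J\in\mathcal{I}_E$. Partitions. An $\mathcal{HK}$-partition in $E$ is a finite collection of pairs $(t_i,I_i)$, $i=1,\dots,p$,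 with $I_i\in\mathcal{I}_E$, $t_i\in I_i$ and the $I_i$ pairwise non-overlapping. It is an $\mathcal{HK}$-partition of $E$ if also $\bigcup_i I_i=E$. It is $Z$-tagged if all $t_i\in Z$. A gauge on $Z$ is a function $\delta:Z\to(0,+\infty)$; a partition with tags in the domain of $\delta$ is $\delta$-fine if $I_i\subset B_m(t_i,\delta(t_i))$ for all $i$. Henstock-Kurzweil integral. For $W\in\mathcal{I}$, $f:W\to X$ is Henstock-Kurzweil integrable on $W$ if there is $x_f\in X$ such that for every $\varepsilon>0$ there is a gauge $\delta$ on $W$ with $\|\sum_{(t,I)\in\pi}f(t)|I|-x_f\|<\varepsilon$ for every $\delta$-fine $\mathcal{HK}$-partition $\pi$ of $W$; then $(HK)\int_W f\,d\lambda=x_f$. In this case $f\cdot\mathbb{1}_I$ is Henstock-Kurzweil integrable on $W$ for every $I\in\mathcal{I}_W$, with integral denoted $(HK)\int_I f\,d\lambda$, and the primitive of $f$ is the additive interval function $\mathcal{I}_W\to X$, $I\mapsto(HK)\int_I f\,d\lambda$. Divisions. Let $E\subset\mathbb{R}^m$ be bounded and Lebesgue measurable with $E^{o}\neq\emptyset$. $\mathscr{P}_E$ is the family of all divisions in $E$, i.e. sequences $(I_k)_{k\ge1}$ of pairwise non-overlapping intervals in $\mathcal{I}_E$. $\mathscr{D}_E$ is the family of all divisions of $E$, i.e. those $(I_k)\in\mathscr{P}_E$ with $E=\bigcup_{k=1}^{\infty}I_k$. (The same notation is used for $E^{o}$.) Dunford-function. An additive interval function $F:\mathcal{I}_E\to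 X$ is a Dunford-function if for every $(I_k)\in\mathscr{P}_E$: (a) the series $\sum_{k:|I\cap I_k|>0}F(I\cap I_k)$ is unconditionally convergent in $X$ for each $I\in\mathcal{I}$; and (b) if $(I_k)\in\mathscr{D}_{E^{o}}$, then $F(I)=\sum_{k:|I\cap I_k|>0}F(I\cap I_k)$ for all $I\in\mathcal{I}_E$. Negligible variation. An additive interval function $F:\mathcal{I}_E\to X$ has $\mathcal{HK}$-negligible variation over (on) $Z\subset\mathbb{R}^m$ if for each $\varepsilon>0$ there is a gauge $\delta_\varepsilon$ on $Z$ such that for each $Z$-tagged $\delta_\varepsilon$-fine $\mathcal{HK}$-partition $\pi$ in $\mathbb{R}^m$ and every $(I_k)\in\mathscr{D}_{E^{o}}$: the series $\sum_{k:|I\cap I_k|>0}F(I\cap I_k)$ is unconditionally convergent in $X$ for each $(t,I)\in\pi$, and $\big\|\sum_{(t,I)\in\pi}\big(\sum_{k:|I\cap I_k|>0}F(I\cap I_k)\big)\big\|<\varepsilon$. Here these notions are applied with $E=I_0$. *)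

theory Defs
  imports "HOL-Analysis.Analysis"
begin

definition max_ball :: "real^'m \<Rightarrow> real \<Rightarrow> (real^'m) set" where
  "max_ball t r = {x. infnorm (x - t) < r}"

definition intervals_in :: "(real^'m) set \<Rightarrow> (real^'m) set set" where
  "intervals_in E = {cbox a b | a b. (\<forall>j. a $ j < b $ j) \<and> cbox a b \<subseteq> E}"

definition nonoverlapping :: "(real^'m) set \<Rightarrow> (real^'m) set \<Rightarrow> bool" where
  "nonoverlapping I J \<longleftrightarrow> interior I \<inter> interior J = {}"

text \<open>Interval functions on the intervals contained in \<open>E\<close> are total set functions;
  only their values on \<^term>\<open>intervals_in E\<close> are ever used.\<close>

definition additive_interval_function ::
    "(real^'m) set \<Rightarrow> ((real^'m) set \<Rightarrow> 'x::banach) \<Rightarrow> bool" where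
  "additive_interval_function E F \<longleftrightarrow>
    (\<forall>I\<in>intervals_in E. \<forall>J\<in>intervals_in E.
       nonoverlapping I J \<and> I \<union> J \<in> intervals_in E \<longrightarrow> F (I \<union> J) = F I + F J)"

text \<open>Non-overlapping non-degenerate intervals are distinct, so a finite family of
  tagged intervals is the same thing as a finite set of pairs.\<close>

definition hk_partition_in :: "(real^'m) set \<Rightarrow> ((real^'m) \<times> (real^'m) set) set \<Rightarrow> bool" where
  "hk_partition_in E \<pi> \<longleftrightarrow>
    finite \<pi> \<and> (\<forall>(t, I)\<in>\<pi>. I \<in> intervals_in E \<and> t \<in> I) \<and>
    pairwise (\<lambda>(s, I) (t, J). nonoverlapping I J) \<pi>"

definition tagged_in :: "(real^'m) set \<Rightarrow> ((real^'m) \<times> (real^'m) set) set \<Rightarrow> bool" where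
  "tagged_in Z \<pi> \<longleftrightarrow> (\<forall>(t, I)\<in>\<pi>. t \<in> Z)"

text \<open>Unlike the library's \<^const>\<open>gauge\<close>, these are positive radius functions.\<close>

definition radius_gauge_on :: "(real^'m) set \<Rightarrow> (real^'m \<Rightarrow> real) \<Rightarrow> bool" where
  "radius_gauge_on Z \<delta> \<longleftrightarrow> (\<forall>t\<in>Z. 0 < \<delta> t)"

definition radius_fine :: "(real^'m \<Rightarrow> real) \<Rightarrow> ((real^'m) \<times> (real^'m) set) set \<Rightarrow> bool" where
  "radius_fine \<delta> \<pi> \<longleftrightarrow> (\<forall>(t, I)\<in>\<pi>. I \<subseteq> max_ball t (\<delta> t))"

definition divisions_in :: "(real^'m) set \<Rightarrow> (nat \<Rightarrow> (real^'m) set) set" where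
  "divisions_in E =
    {S. (\<forall>k. S k \<in> intervals_in E) \<and> (\<forall>j k. j \<noteq> k \<longrightarrow> nonoverlapping (S j) (S k))}"

definition divisions_of :: "(real^'m) set \<Rightarrow> (nat \<Rightarrow> (real^'m) set) set" where
  "divisions_of E = {S \<in> divisions_in E. E = (\<Union>k. S k)}"

text \<open>Unconditional convergence of a series is \<open>summable_on\<close>: convergence of the net of
  finite partial sums. The sum over the indices \<open>k\<close> with \<open>|I \<inter> S k| > 0\<close> is taken over
  the following index set.\<close>

definition overlap_indices :: "(nat \<Rightarrow> (real^'m) set) \<Rightarrow> (real^'m) set \<Rightarrow> nat set" where
  "overlap_indices S I = {k. measure lebesgue (I \<inter> S k) > 0}"

definition dunford_function ::
    "(real^'m) set \<Rightarrow> ((real^'m) set \<Rightarrow> 'x::banach) \<Rightarrow> bool" where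
  "dunford_function E F \<longleftrightarrow>
    additive_interval_function E F \<and>
    (\<forall>S\<in>divisions_in E.
       (\<forall>I\<in>intervals_in UNIV. (\<lambda>k. F (I \<inter> S k)) summable_on overlap_indices S I) \<and>
       (S \<in> divisions_of (interior E) \<longrightarrow>
         (\<forall>I\<in>intervals_in E. F I = (\<Sum>\<^sub>\<infinity>k\<in>overlap_indices S I. F (I \<inter> S k)))))"

definition hk_negligible_variation ::
    "(real^'m) set \<Rightarrow> ((real^'m) set \<Rightarrow> 'x::banach) \<Rightarrow> (real^'m) set \<Rightarrow> bool" where
  "hk_negligible_variation E F Z \<longleftrightarrow>
    (\<forall>\<epsilon>>0. \<exists>\<delta>. radius_gauge_on Z \<delta> \<and>
      (\<forall>\<pi>. hk_partition_in UNIV \<pi> \<and> tagged_in Z \<pi> \<and> radius_fine \<delta> \<pi> \<longrightarrow>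
        (\<forall>S\<in>divisions_of (interior E).
          (\<forall>(t, I)\<in>\<pi>. (\<lambda>k. F (I \<inter> S k)) summable_on overlap_indices S I) \<and>
          norm (\<Sum>(t, I)\<in>\<pi>. \<Sum>\<^sub>\<infinity>k\<in>overlap_indices S I. F (I \<inter> S k)) < \<epsilon>)))"

text \<open>\<open>integrable_on\<close> and \<open>has_integral\<close> on a box are the library's Henstock--Kurzweil integral.
  The integral over a subinterval \<open>I\<close> is the integral over \<open>W\<close> of the product with the
  characteristic function of \<open>I\<close>.\<close>

definition hk_integrable_with_primitive ::
    "(real^'m) set \<Rightarrow> (real^'m \<Rightarrow> 'x::banach) \<Rightarrow> ((real^'m) set \<Rightarrow> 'x) \<Rightarrow> bool" where
  "hk_integrable_with_primitive W f F \<longleftrightarrow>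
    f integrable_on W \<and>
    (\<forall>I\<in>intervals_in W. ((\<lambda>t. indicat_real I t *\<^sub>R f t) has_integral F I) W)"

end

theory Submission
  imports Defs
begin

text \<open>For a Dunford-function the series in the definition of negligible variation sums to the
  value of \<open>F\<close> on the trace of \<open>I\<close> on \<open>E\<close>, so that condition says: the sum of \<open>F\<close> over the traces
  of a fine family of intervals tagged on the boundary is small. Since the boundary is negligible,
  the integrand may be taken to vanish there. If \<open>F\<close> is the primitive, the Saks--Henstock lemma
  for the original and for the modified integrand gives the two conditions. Conversely, a gauge
  for interior tags, shrunk so that fine intervals stay in the interior, and a gauge for boundary
  tags combine to one gauge, which shows directly that \<open>F J\<close> is the integral over every
  subinterval \<open>J\<close>.\<close>

section \<open>Intervals and balls of the maximum norm\<close>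

text \<open>The interior of \<open>cbox a b\<close> is the open box, nonempty exactly when every
  side has positive length. Nondegeneracy thus becomes a condition on interiors, which suits
  intersections and non-overlap.\<close>

lemma intervals_in_iff:
  fixes I :: "(real^'m) set"
  shows "I \<in> intervals_in E \<longleftrightarrow> (\<exists>a b. I = cbox a b) \<and> interior I \<noteq> {} \<and> I \<subseteq> E"
proof -
  have "interior (cbox a b) \<noteq> {} \<longleftrightarrow> (\<forall>j. a $ j < b $ j)" for a b :: "real^'m"
    by (simp only: interior_cbox interval_ne_empty_cart)
  then show ?thesis
    unfolding intervals_in_def by blast
qed

lemma measure_lebesgue_pos_iff_interior:
  "0 < measure lebesgue (cbox a b) \<longleftrightarrow> interior (cbox a b) \<noteq> {}"
proof -
  have "measure lebesgue (cbox a b) = measure lborel (cbox a b)"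
    by simp
  then show ?thesis
    using content_eq_0_interior[of a b] content_lt_nz[of a b] by metis
qed

lemma Int_interval_in:
  assumes "I \<in> intervals_in A" "J \<in> intervals_in E" "interior (I \<inter> J) \<noteq> {}"
  shows "I \<inter> J \<in> intervals_in E"
proof -
  obtain a b where "I = cbox a b"
    using assms(1) unfolding intervals_in_iff by blast
  moreover obtain c d where "J = cbox c d"
    using assms(2) unfolding intervals_in_iff by blast
  ultimately have "\<exists>u v. I \<inter> J = cbox u v"
    using Int_interval by blast
  then show ?thesis
    using assms(2,3) unfolding intervals_in_iff by blast
qed

lemma open_max_ball: "open (max_ball t r)"
proof -
  have "continuous_on UNIV (\<lambda>x. infnorm (x - t))"
    by (intro continuous_intros continuous_on_infnorm)
  then show ?thesis
    unfolding max_ball_def by (intro open_Collect_less continuous_on_const)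
qed

lemma centre_in_max_ball: "0 < r \<Longrightarrow> t \<in> max_ball t r"
  by (simp add: max_ball_def infnorm_0)

lemma open_contains_max_ball:
  fixes t :: "real^'m"
  assumes "open U" "t \<in> U"
  obtains r where "r > 0" "max_ball t r \<subseteq> U"
proof -
  obtain e where e: "e > 0" "ball t e \<subseteq> U"
    using assms open_contains_ball by blast
  \<comment> \<open>The Euclidean norm is at most \<open>c\<close> times the maximum norm, so the
    radius \<open>e / c\<close> suffices.\<close>
  define c where "c = sqrt (real DIM(real^'m))"
  have c: "c > 0"
    by (simp add: c_def)
  have "max_ball t (e / c) \<subseteq> ball t e"
  proof
    fix x assume "x \<in> max_ball t (e / c)"
    then have "c * infnorm (x - t) < e"
      using c by (simp add: max_ball_def field_simps)
    then show "x \<in> ball t e"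
      using norm_le_infnorm[of "x - t"] by (simp add: c_def dist_norm norm_minus_commute)
  qed
  with e c that[of "e / c"] show thesis
    by (metis divide_pos_pos subset_trans)
qed

text \<open>Passes from the set-valued gauges of the library to radius functions: a
  \<open>\<delta>\<close>-fine partition is then \<open>\<gamma>\<close>-fine.\<close>

lemma gauge_contains_max_ball:
  fixes \<gamma> :: "real^'m \<Rightarrow> (real^'m) set"
  assumes "gauge \<gamma>"
  obtains \<delta> where "\<And>t. 0 < \<delta> t" "\<And>t. max_ball t (\<delta> t) \<subseteq> \<gamma> t"
proof -
  have "\<exists>r>0. max_ball t r \<subseteq> \<gamma> t" for t
    using assms open_contains_max_ball by (metis gauge_def)
  then show thesis
    using that by metis
qed

section \<open>Partitions and tagged partial divisions\<close>

lemma hk_partition_in_imp_tagged_partial_division: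
  assumes "hk_partition_in E \<pi>"
  shows "\<pi> tagged_partial_division_of E"
  unfolding tagged_partial_division_of_def
proof (intro conjI allI impI)
  show "finite \<pi>"
    using assms by (simp add: hk_partition_in_def)
  show "x \<in> K" "K \<subseteq> E" "\<exists>a b. K = cbox a b" if "(x, K) \<in> \<pi>" for x K
    using assms that by (auto simp: hk_partition_in_def intervals_in_iff)
  show "interior K \<inter> interior L = {}"
    if "(x, K) \<in> \<pi> \<and> (y, L) \<in> \<pi> \<and> (x, K) \<noteq> (y, L)" for x K y L
  proof -
    have "pairwise (\<lambda>(s, I) (t, J). nonoverlapping I J) \<pi>"
      using assms by (simp add: hk_partition_in_def)
    from pairwiseD[OF this, of "(x, K)" "(y, L)"] that show ?thesis
      by (simp add: nonoverlapping_def)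
  qed
qed

text \<open>Tagged partial divisions may contain degenerate boxes, which are not intervals here.
  Removing them does not change a Riemann sum, since their content is 0.\<close>

lemma tagged_partial_division_imp_hk_partition_in:
  assumes "p tagged_partial_division_of E"
  shows "hk_partition_in E {(t, K) \<in> p. interior K \<noteq> {}}"
proof -
  have "finite {(t, K) \<in> p. interior K \<noteq> {}}"
    using assms by (auto intro: finite_subset[of _ p] simp: tagged_partial_division_of_def)
  then show ?thesis
    using tagged_partial_division_ofD[OF assms]
    unfolding hk_partition_in_def
    by (auto simp: intervals_in_iff pairwise_def nonoverlapping_def; blast)
qed

lemma hk_partition_in_subset:
  assumes "hk_partition_in E \<pi>" "\<rho> \<subseteq> \<pi>"
  shows "hk_partition_in E \<rho>"
  using assms finite_subset[OF assms(2)] pairwise_subset[OF _ assms(2)]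
  unfolding hk_partition_in_def by blast

lemma intervals_in_mono: "E \<subseteq> D \<Longrightarrow> intervals_in E \<subseteq> intervals_in D"
  unfolding intervals_in_def by blast

lemma hk_partition_in_superset:
  assumes "hk_partition_in E \<pi>" "E \<subseteq> D"
  shows "hk_partition_in D \<pi>"
  using assms(1) intervals_in_mono[OF assms(2)] unfolding hk_partition_in_def by blast

section \<open>Additive extension of an interval function by traces\<close>

text \<open>Giving the value \<open>0\<close> to degenerate traces makes the extension additive on all boxes, as
  the library's tagged divisions, which admit degenerate boxes, require.\<close>

definition clip :: "(real^'m) set \<Rightarrow> ((real^'m) set \<Rightarrow> 'x::banach) \<Rightarrow> (real^'m) set \<Rightarrow> 'x" where
  "clip E F I = (if interior (I \<inter> E) = {} then 0 else F (I \<inter> E))"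

lemma clip_eq: "I \<in> intervals_in E \<Longrightarrow> clip E F I = F I"
  by (simp add: clip_def intervals_in_iff Int_absorb2)

lemma clip_empty_interior: "interior I = {} \<Longrightarrow> clip E F I = 0"
  by (simp add: clip_def)

text \<open>A hyperplane cuts the trace \<open>I\<close> into boxes \<open>L\<close> and
  \<open>R\<close>. If both are nondegenerate, additivity of \<open>F\<close> applies. If one is
  degenerate, a nondegenerate \<open>I\<close> coincides with the other.\<close>

lemma operative_clip:
  fixes E :: "(real^'m) set"
  assumes E: "E \<in> intervals_in UNIV" and F: "additive_interval_function E F"
  shows "operative (+) 0 (clip E F)"
proof
  fix a b :: "real^'m" assume "box a b = {}"
  then show "clip E F (cbox a b) = 0"
    by (simp add: clip_empty_interior interior_cbox)
next
  fix a b k :: "real^'m" and c :: real assume k: "k \<in> Basis"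
  define I where "I = cbox a b \<inter> E"
  define L where "L = cbox a b \<inter> {x. x \<bullet> k \<le> c} \<inter> E"
  define R where "R = cbox a b \<inter> {x. x \<bullet> k \<ge> c} \<inter> E"
  obtain e e' where e: "E = cbox e e'"
    using E by (auto simp: intervals_in_iff)
  have box: "\<exists>u v. I = cbox u v" "\<exists>u v. L = cbox u v" "\<exists>u v. R = cbox u v"
    unfolding I_def L_def R_def e interval_split[OF k] Int_interval by blast+
  have LR: "L \<union> R = I"
    by (auto simp: I_def L_def R_def)
  \<comment> \<open>For a nonzero normal the two closed half-spaces have the open half-spaces as
    interiors, and these are disjoint.\<close>
  have "k \<noteq> 0"
    using k by auto
  have "interior L \<subseteq> interior {x. k \<bullet> x \<le> c}" "interior R \<subseteq> interior {x. k \<bullet> x \<ge> c}"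
    by (auto intro!: interior_mono simp: L_def R_def inner_commute)
  then have disj: "nonoverlapping L R"
    using \<open>k \<noteq> 0\<close> by (force simp: nonoverlapping_def)
  \<comment> \<open>A closed convex set with nonempty interior is the closure of its
    interior.\<close>
  have eqI: "I = J" if "interior I = interior J" "interior J \<noteq> {}" "\<exists>u v. J = cbox u v" for J
    using that box(1) convex_closure_interior[of I] convex_closure_interior[of J]
    by (metis closed_cbox closure_closed convex_box(1))
  have sub: "L \<subseteq> E" "R \<subseteq> E" "I \<subseteq> E"
    by (auto simp: I_def L_def R_def)
  have cl: "closed L" "closed R"
    using box closed_cbox by blast+
  have split: "(if interior I = {} then 0 else F I) =
      (if interior L = {} then 0 else F L) + (if interior R = {} then 0 else F R)"
  proof (cases "interior L = {} \<or> interior R = {}")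
    case True
    \<comment> \<open>A closed set with empty interior adds nothing to the interior of a
      union.\<close>
    then consider "interior L = {}" "interior I = interior R"
      | "interior R = {}" "interior I = interior L"
      using interior_closed_Un_empty_interior[OF cl(1), of R]
        interior_closed_Un_empty_interior[OF cl(2), of L] LR by (metis Un_commute)
    then show ?thesis
      by cases (use eqI box in auto)
  next
    case False
    moreover have "interior L \<subseteq> interior I"
      using LR by (intro interior_mono) auto
    ultimately have "interior I \<noteq> {}"
      by auto
    then have "L \<in> intervals_in E" "R \<in> intervals_in E" "I \<in> intervals_in E"
      using False sub box by (auto simp: intervals_in_iff)
    with disj F LR False \<open>interior I \<noteq> {}\<close> show ?thesis
      unfolding additive_interval_function_def by auto
  qed
  then show "clip E F (cbox a b) =
      clip E F (cbox a b \<inter> {x. x \<bullet> k \<le> c}) + clip E F (cbox a b \<inter> {x. x \<bullet> k \<ge> c})"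
    by (simp only: clip_def I_def[symmetric] L_def[symmetric] R_def[symmetric])
qed

lemma sum_clip_tagged_division:
  assumes "E \<in> intervals_in UNIV" "additive_interval_function E F" "p tagged_division_of cbox a b"
  shows "(\<Sum>(t, K)\<in>p. clip E F K) = clip E F (cbox a b)"
proof -
  interpret operative "(+)" 0 "clip E F"
    rewrites "comm_monoid_set.F (+) 0 = sum"
    using operative_clip[OF assms(1,2)] by (simp_all add: sum_def)
  show ?thesis
    using tagged_division[OF assms(3)] .
qed

section \<open>Divisions of the interior and their series\<close>

lemma divisions_of_interior_subset: "divisions_of (interior E) \<subseteq> divisions_in E"
  using intervals_in_mono[OF interior_subset[of E]]
  unfolding divisions_of_def divisions_in_def by blast

text \<open>All \<open>S k\<close> lie in \<open>E\<close>, so replacing \<open>I\<close> by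
  \<open>I \<inter> E\<close> changes neither the terms nor the index set. For a nondegenerate
  trace, clause (b) of a Dunford-function gives the value. For a degenerate one, every
  \<open>I \<inter> S k\<close> is a null box and the sum is empty. The result does not depend on
  \<open>S\<close>.\<close>

lemma infsum_division_eq_clip:
  assumes F: "dunford_function E F" and E: "E \<in> intervals_in UNIV"
    and S: "S \<in> divisions_of (interior E)" and I: "I \<in> intervals_in UNIV"
  shows "(\<Sum>\<^sub>\<infinity>k\<in>overlap_indices S I. F (I \<inter> S k)) = clip E F I"
proof -
  have SE: "S k \<subseteq> E" for k
    using S divisions_of_interior_subset by (fastforce simp: divisions_in_def intervals_in_iff)
  then have Int: "I \<inter> S k = I \<inter> E \<inter> S k" for k
    by auto
  show ?thesis
  proof (cases "interior (I \<inter> E) = {}")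
    case True
    have "k \<notin> overlap_indices S I" for k
    proof -
      obtain u v where uv: "I \<inter> S k = cbox u v"
      proof -
        have "S k \<in> intervals_in (interior E)"
          using S unfolding divisions_of_def divisions_in_def by blast
        then obtain c d where "S k = cbox c d"
          unfolding intervals_in_iff by blast
        moreover obtain c' d' where "I = cbox c' d'"
          using I unfolding intervals_in_iff by blast
        ultimately show ?thesis
          using that Int_interval by blast
      qed
      have "interior (I \<inter> S k) \<subseteq> interior (I \<inter> E)"
        using SE by (intro interior_mono) auto
      with True have "interior (cbox u v) = {}"
        unfolding uv by blast
      then have "\<not> 0 < measure lebesgue (I \<inter> S k)"
        unfolding uv measure_lebesgue_pos_iff_interior by blast
      then show ?thesis
        unfolding overlap_indices_def by blast
    qed
    then have "overlap_indices S I = {}"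
      by blast
    with True show ?thesis
      by (simp add: clip_def)
  next
    case False
    then have "I \<inter> E \<in> intervals_in E"
      using Int_interval_in[OF I E] by (simp add: intervals_in_iff)
    moreover have "overlap_indices S (I \<inter> E) = overlap_indices S I"
      by (simp only: overlap_indices_def Int[symmetric])
    moreover have "S \<in> divisions_in E"
      using S divisions_of_interior_subset by blast
    ultimately have "F (I \<inter> E) = (\<Sum>\<^sub>\<infinity>k\<in>overlap_indices S I. F (I \<inter> E \<inter> S k))"
      using F S unfolding dunford_function_def by metis
    with False show ?thesis
      by (simp only: clip_def if_False Int[symmetric])
  qed
qed

text \<open>Negligible variation quantifies over all divisions of the interior and would be vacuous
  without one. The covering lemma supplies a countable family of non-overlapping boxes, to be
  enumerated as a sequence.\<close>

lemma divisions_of_interior_nonempty: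
  fixes E :: "(real^'m) set"
  assumes E: "E \<in> intervals_in UNIV"
  shows "divisions_of (interior E) \<noteq> {}"
proof -
  obtain a b where ab: "E = cbox a b" "box a b \<noteq> {}"
    using E unfolding intervals_in_iff by (metis interior_cbox)
  \<comment> \<open>Each box \<open>K\<close> of the covering lies in \<open>g x\<close> for some
    \<open>x\<close> in the open box, so this gauge keeps \<open>K\<close> inside the open
    box.\<close>
  define g where "g x = (if x \<in> box a b then box a b else UNIV)" for x
  have "gauge g"
    by (auto simp: gauge_def g_def open_box)
  from covering_lemma[OF box_subset_cbox ab(2) this]
  obtain D where D: "countable D"
    "\<And>K. K \<in> D \<Longrightarrow> interior K \<noteq> {} \<and> (\<exists>c d. K = cbox c d)"
    "pairwise (\<lambda>A B. interior A \<inter> interior B = {}) D"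
    "\<And>K. K \<in> D \<Longrightarrow> \<exists>x \<in> box a b \<inter> K. K \<subseteq> g x"
    "box a b \<subseteq> \<Union>D"
    by metis
  have sub: "K \<subseteq> box a b" if "K \<in> D" for K
    using D(4)[OF that] by (auto simp: g_def)
  have U: "\<Union>D = box a b"
    using sub D(5) by blast
  \<comment> \<open>An injective enumeration by all naturals needs an infinite family. A finite
    union of closed boxes would be compact, but a nonempty bounded open set is not closed.\<close>
  have "infinite D"
  proof
    assume "finite D"
    then have "compact (\<Union>D)"
      using D(2) by (metis compact_Union compact_cbox)
    then have "closed (box a b)"
      using U compact_imp_closed by metis
    then have "box a b = UNIV"
      using ab(2) open_box clopen by blast
    then show False
      using bounded_box not_bounded_UNIV by metis
  qed
  then have bij: "bij_betw (from_nat_into D) UNIV D"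
    using D(1) bij_betw_from_nat_into by blast
  have mem: "from_nat_into D k \<in> D" for k
    using bij by (auto simp: bij_betw_def)
  have "from_nat_into D \<in> divisions_of (interior E)"
    unfolding divisions_of_def divisions_in_def
  proof (intro CollectI conjI allI impI)
    show "from_nat_into D k \<in> intervals_in (interior E)" for k
      using D(2)[OF mem[of k]] sub[OF mem[of k]] by (simp add: intervals_in_iff ab interior_cbox)
    show "nonoverlapping (from_nat_into D j) (from_nat_into D k)" if "j \<noteq> k" for j k
    proof -
      have "from_nat_into D j \<noteq> from_nat_into D k"
        using bij that by (auto simp: bij_betw_def inj_on_def)
      then show ?thesis
        using D(3) mem by (auto simp: pairwise_def nonoverlapping_def)
    qed
    show "interior E = (\<Union>k. from_nat_into D k)"
      using bij U by (simp add: bij_betw_def ab interior_cbox)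
  qed
  then show ?thesis
    by blast
qed

section \<open>Traces of partitions\<close>

text \<open>Intervals tagged on the boundary may leave \<open>E\<close>. Their nondegenerate traces
  keep the tags, stay fine because they only shrink, and form a partition in \<open>E\<close>. The
  degenerate traces contribute 0 to the sum of \<open>clip\<close>.\<close>

lemma sum_clip_eq_sum_clipped_partition:
  assumes E: "E \<in> intervals_in UNIV" and \<pi>: "hk_partition_in UNIV \<pi>" "tagged_in E \<pi>" "radius_fine \<delta> \<pi>"
  obtains \<rho> where "hk_partition_in E \<rho>" "radius_fine \<delta> \<rho>" "fst ` \<rho> \<subseteq> fst ` \<pi>"
    "(\<Sum>(t, I)\<in>\<pi>. clip E F I) = (\<Sum>(t, J)\<in>\<rho>. F J)"
proof -
  define \<sigma> where "\<sigma> = {(t, I) \<in> \<pi>. interior (I \<inter> E) \<noteq> {}}"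
  define h where "h = (\<lambda>(t :: real^'a, I). (t, I \<inter> E))"
  have \<sigma>: "hk_partition_in UNIV \<sigma>"
    using \<pi>(1) by (rule hk_partition_in_subset) (auto simp: \<sigma>_def)
  have fin: "finite \<pi>" "finite \<sigma>"
    using \<pi>(1) \<sigma> by (auto simp: hk_partition_in_def)
  have dis: "interior I \<inter> interior J = {}"
    if "(s, I) \<in> \<sigma>" "(t, J) \<in> \<sigma>" "(s, I) \<noteq> (t, J)" for s t I J
    using tagged_partial_division_ofD(5)[OF hk_partition_in_imp_tagged_partial_division[OF \<sigma>]] that .
  \<comment> \<open>The nonempty interior of a common trace would lie in the interiors of two
    non-overlapping intervals.\<close>
  have inj: "inj_on h \<sigma>"
  proof (rule inj_onI, clarify)
    fix s I t J assume *: "(s, I) \<in> \<sigma>" "(t, J) \<in> \<sigma>" "h (s, I) = h (t, J)"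
    then have "I \<inter> E = J \<inter> E" "interior (I \<inter> E) \<noteq> {}"
      by (simp_all add: h_def \<sigma>_def del: interior_Int)
    then have "I \<inter> E \<subseteq> I" "I \<inter> E \<subseteq> J" "interior (I \<inter> E) \<noteq> {}"
      by blast+
    then have "interior (I \<inter> E) \<subseteq> interior I \<inter> interior J" "interior (I \<inter> E) \<noteq> {}"
      by (meson interior_mono le_inf_iff)+
    then show "s = t \<and> I = J"
      using dis[OF *(1,2)] by auto
  qed
  show thesis
  proof (rule that)
    have "I \<inter> E \<in> intervals_in E" "t \<in> I \<inter> E" if "(t, I) \<in> \<sigma>" for t I
    proof -
      have "interior (I \<inter> E) \<noteq> {}" "(t, I) \<in> \<pi>"
        using that unfolding \<sigma>_def by blast+
      moreover from this have "I \<in> intervals_in UNIV" "t \<in> I" "t \<in> E"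
        using \<pi> by (auto simp: hk_partition_in_def tagged_in_def)
      moreover have "E \<in> intervals_in E"
        using E by (simp add: intervals_in_iff)
      ultimately show "I \<inter> E \<in> intervals_in E" "t \<in> I \<inter> E"
        using Int_interval_in by blast+
    qed
    moreover have "pairwise (\<lambda>(s, I) (t, J). nonoverlapping I J) (h ` \<sigma>)"
      unfolding pairwise_def nonoverlapping_def h_def using dis by fastforce
    ultimately show "hk_partition_in E (h ` \<sigma>)"
      using fin by (auto simp: hk_partition_in_def h_def)
    show "radius_fine \<delta> (h ` \<sigma>)"
      using \<pi>(3) by (fastforce simp: radius_fine_def h_def \<sigma>_def)
    show "fst ` h ` \<sigma> \<subseteq> fst ` \<pi>"
      by (force simp: h_def \<sigma>_def)
    have "(\<Sum>(t, I)\<in>\<pi>. clip E F I) = (\<Sum>(t, I)\<in>\<sigma>. clip E F I)"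
      by (rule sum.mono_neutral_right[OF fin(1)]) (auto simp: \<sigma>_def clip_def)
    also have "\<dots> = (\<Sum>x\<in>\<sigma>. (\<lambda>(t, J). F J) (h x))"
      by (rule sum.cong) (simp_all add: \<sigma>_def clip_def h_def split_beta del: interior_Int)
    also have "\<dots> = (\<Sum>(t, J)\<in>h ` \<sigma>. F J)"
      using inj by (simp add: sum.reindex)
    finally show "(\<Sum>(t, I)\<in>\<pi>. clip E F I) = (\<Sum>(t, J)\<in>h ` \<sigma>. F J)" .
  qed
qed

section \<open>Primitives and the Saks-Henstock lemma\<close>

text \<open>Multiplying by the characteristic function amounts to integrating over the subinterval.
  Integrability on \<open>E\<close> is the instance \<open>I = E\<close>.\<close>

lemma hk_primitive_iff:
  assumes "E \<in> intervals_in UNIV"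
  shows "hk_integrable_with_primitive E f F \<longleftrightarrow> (\<forall>I\<in>intervals_in E. (f has_integral F I) I)"
proof -
  have "((\<lambda>t. indicat_real I t *\<^sub>R f t) has_integral y) E \<longleftrightarrow> (f has_integral y) I" if "I \<subseteq> E" for I y
  proof -
    have "(\<lambda>t. indicat_real I t *\<^sub>R f t) = (\<lambda>t. if t \<in> I then f t else 0)"
      by (auto simp: indicator_def)
    then show ?thesis
      using has_integral_restrict[OF that] by simp
  qed
  moreover have "E \<in> intervals_in E"
    using assms by (simp add: intervals_in_iff)
  ultimately show ?thesis
    unfolding hk_integrable_with_primitive_def
    by (metis has_integral_integrable intervals_in_iff)
qed

lemma measure_lebesgue_interval: "I \<in> intervals_in E \<Longrightarrow> measure lebesgue I = measure lborel I"
  by (auto simp: intervals_in_iff)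

text \<open>The gauge for the integral over all of \<open>E\<close> also controls partitions that do
  not cover \<open>E\<close>, with each integral over \<open>I\<close> written as
  \<open>F I\<close>.\<close>

lemma Saks_Henstock_radius_gauge:
  fixes f :: "real^'m \<Rightarrow> 'x::banach"
  assumes E: "E \<in> intervals_in UNIV" and f: "\<And>I. I \<in> intervals_in E \<Longrightarrow> (f has_integral F I) I"
    and "\<epsilon> > 0"
  obtains \<delta> where "\<And>t. 0 < \<delta> t"
    "\<And>\<pi>. hk_partition_in E \<pi> \<Longrightarrow> radius_fine \<delta> \<pi> \<Longrightarrow>
      norm (\<Sum>(t, I)\<in>\<pi>. measure lebesgue I *\<^sub>R f t - F I) < \<epsilon>"
proof -
  obtain a b where ab: "E = cbox a b"
    using E by (auto simp: intervals_in_iff)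
  have int: "(f has_integral F E) (cbox a b)"
    using f[of E] E by (simp add: intervals_in_iff ab)
  \<comment> \<open>Halving turns the non-strict bound of the Henstock lemma into a strict
    one.\<close>
  have "\<epsilon> / 2 > 0"
    using \<open>\<epsilon> > 0\<close> by simp
  then obtain \<gamma> where \<gamma>: "gauge \<gamma>"
    "\<And>p. p tagged_division_of cbox a b \<Longrightarrow> \<gamma> fine p \<Longrightarrow>
      norm ((\<Sum>(x, K)\<in>p. measure lborel K *\<^sub>R f x) - integral (cbox a b) f) < \<epsilon> / 2"
    using int unfolding has_integral integral_unique[OF int] by meson
  obtain \<delta> where \<delta>: "\<And>t. 0 < \<delta> t" "\<And>t. max_ball t (\<delta> t) \<subseteq> \<gamma> t"
    using gauge_contains_max_ball[OF \<gamma>(1)] by metis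
  show thesis
  proof (rule that[OF \<delta>(1)])
    fix \<pi> assume \<pi>: "hk_partition_in E \<pi>" "radius_fine \<delta> \<pi>"
    have "\<gamma> fine \<pi>"
      using \<pi>(2) \<delta>(2) by (fastforce simp: fine_def radius_fine_def)
    then have "norm (\<Sum>(x, K)\<in>\<pi>. measure lborel K *\<^sub>R f x - integral K f) \<le> \<epsilon> / 2"
      using Henstock_lemma_part1[OF has_integral_integrable[OF int] \<open>\<epsilon> / 2 > 0\<close> \<gamma>]
        hk_partition_in_imp_tagged_partial_division[OF \<pi>(1)] ab by blast
    also have "(\<Sum>(x, K)\<in>\<pi>. measure lborel K *\<^sub>R f x - integral K f) =
        (\<Sum>(t, I)\<in>\<pi>. measure lebesgue I *\<^sub>R f t - F I)"
    proof (rule sum.cong[OF refl], clarify)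
      fix t I assume "(t, I) \<in> \<pi>"
      then have "I \<in> intervals_in E"
        using \<pi>(1) by (auto simp: hk_partition_in_def)
      then show "measure lborel I *\<^sub>R f t - integral I f = measure lebesgue I *\<^sub>R f t - F I"
        using integral_unique[OF f] measure_lebesgue_interval by metis
    qed
    finally show "norm (\<Sum>(t, I)\<in>\<pi>. measure lebesgue I *\<^sub>R f t - F I) < \<epsilon>"
      using \<open>\<epsilon> > 0\<close> by linarith
  qed
qed

text \<open>The interior of \<open>I\<close> lies in the interior of \<open>E\<close>, so inside
  \<open>I\<close> the two functions can differ only on the negligible frontier of
  \<open>I\<close>.\<close>

lemma has_integral_interval_spike_boundary:
  fixes f g :: "real^'m \<Rightarrow> 'x::banach"
  assumes I: "I \<in> intervals_in E" and fg: "\<And>x. x \<in> interior E \<Longrightarrow> g x = f x"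
    and f: "(f has_integral y) I"
  shows "(g has_integral y) I"
proof -
  obtain a b where ab: "I = cbox a b" "I \<subseteq> E"
    using I by (auto simp: intervals_in_iff)
  have "g x = f x" if "x \<in> box a b" for x
    using that fg interior_mono[OF ab(2)] by (auto simp: ab(1) interior_cbox)
  then show ?thesis
    using has_integral_spike_interior f ab(1) by metis
qed

section \<open>From the integral to negligible variation\<close>

text \<open>The Saks-Henstock gauge is taken for \<open>f0\<close>, which has the same primitive and
  vanishes on the boundary. At boundary tags the Riemann terms disappear and only the sum of
  \<open>F\<close> over the traces remains.\<close>

lemma negligible_variation_of_primitive:
  assumes E: "E \<in> intervals_in UNIV" and F: "dunford_function E F"
    and f: "\<And>I. I \<in> intervals_in E \<Longrightarrow> (f has_integral F I) I"
  shows "hk_negligible_variation E F (E - interior E)"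
  unfolding hk_negligible_variation_def
proof (intro allI impI)
  fix \<epsilon> :: real assume "\<epsilon> > 0"
  define f0 where "f0 x = (if x \<in> interior E then f x else 0)" for x
  have f0: "(f0 has_integral F I) I" if "I \<in> intervals_in E" for I
    by (rule has_integral_interval_spike_boundary[OF that _ f[OF that]]) (simp add: f0_def)
  obtain \<delta> where \<delta>: "\<And>t. 0 < \<delta> t"
    "\<And>\<pi>. hk_partition_in E \<pi> \<Longrightarrow> radius_fine \<delta> \<pi> \<Longrightarrow>
      norm (\<Sum>(t, I)\<in>\<pi>. measure lebesgue I *\<^sub>R f0 t - F I) < \<epsilon>"
    using Saks_Henstock_radius_gauge[OF E f0 \<open>\<epsilon> > 0\<close>] by blast
  have "(\<forall>(t, I)\<in>\<pi>. (\<lambda>k. F (I \<inter> S k)) summable_on overlap_indices S I) \<and>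
      norm (\<Sum>(t, I)\<in>\<pi>. \<Sum>\<^sub>\<infinity>k\<in>overlap_indices S I. F (I \<inter> S k)) < \<epsilon>"
    if \<pi>: "hk_partition_in UNIV \<pi>" "tagged_in (E - interior E) \<pi>" "radius_fine \<delta> \<pi>"
      and S: "S \<in> divisions_of (interior E)" for \<pi> S
  proof
    have ints: "I \<in> intervals_in UNIV" if "(t, I) \<in> \<pi>" for t I
      using \<pi>(1) that by (auto simp: hk_partition_in_def)
    show "\<forall>(t, I)\<in>\<pi>. (\<lambda>k. F (I \<inter> S k)) summable_on overlap_indices S I"
      using F S ints divisions_of_interior_subset unfolding dunford_function_def by blast
    have tag: "tagged_in E \<pi>"
      using \<pi>(2) by (auto simp: tagged_in_def)
    obtain \<rho> where \<rho>: "hk_partition_in E \<rho>" "radius_fine \<delta> \<rho>" "fst ` \<rho> \<subseteq> fst ` \<pi>"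
      "(\<Sum>(t, I)\<in>\<pi>. clip E F I) = (\<Sum>(t, J)\<in>\<rho>. F J)"
      using sum_clip_eq_sum_clipped_partition[OF E \<pi>(1) tag \<pi>(3)] by blast
    have "f0 t = 0" if "(t, J) \<in> \<rho>" for t J
    proof -
      have "t \<in> fst ` \<pi>"
        using that \<rho>(3) by force
      then have "t \<in> E - interior E"
        using \<pi>(2) by (auto simp: tagged_in_def)
      then show ?thesis
        by (simp add: f0_def)
    qed
    then have "(\<Sum>(t, J)\<in>\<rho>. measure lebesgue J *\<^sub>R f0 t - F J) = (\<Sum>(t, J)\<in>\<rho>. - F J)"
      by (intro sum.cong) auto
    then have "norm (\<Sum>(t, J)\<in>\<rho>. F J) < \<epsilon>"
      using \<delta>(2)[OF \<rho>(1,2)] by (simp add: sum_negf split_def)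
    moreover have "(\<Sum>(t, I)\<in>\<pi>. \<Sum>\<^sub>\<infinity>k\<in>overlap_indices S I. F (I \<inter> S k)) = (\<Sum>(t, I)\<in>\<pi>. clip E F I)"
      by (rule sum.cong) (auto intro: infsum_division_eq_clip[OF F E S] ints)
    ultimately show "norm (\<Sum>(t, I)\<in>\<pi>. \<Sum>\<^sub>\<infinity>k\<in>overlap_indices S I. F (I \<inter> S k)) < \<epsilon>"
      using \<rho>(4) by simp
  qed
  moreover have "radius_gauge_on (E - interior E) \<delta>"
    using \<delta>(1) by (simp add: radius_gauge_on_def)
  ultimately show "\<exists>\<delta>. radius_gauge_on (E - interior E) \<delta> \<and>
      (\<forall>\<pi>. hk_partition_in UNIV \<pi> \<and> tagged_in (E - interior E) \<pi> \<and> radius_fine \<delta> \<pi> \<longrightarrow>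
        (\<forall>S\<in>divisions_of (interior E).
          (\<forall>(t, I)\<in>\<pi>. (\<lambda>k. F (I \<inter> S k)) summable_on overlap_indices S I) \<and>
          norm (\<Sum>(t, I)\<in>\<pi>. \<Sum>\<^sub>\<infinity>k\<in>overlap_indices S I. F (I \<inter> S k)) < \<epsilon>))"
    by blast
qed

section \<open>From the two conditions to the integral\<close>

text \<open>The series has the same value for every division, so one division suffices to rewrite
  the condition in terms of \<open>clip\<close>.\<close>

lemma negligible_variation_sum_clip:
  assumes E: "E \<in> intervals_in UNIV" and F: "dunford_function E F"
    and neg: "hk_negligible_variation E F Z" and "\<epsilon> > 0"
  obtains \<delta> where "radius_gauge_on Z \<delta>"
    "\<And>\<pi>. hk_partition_in UNIV \<pi> \<Longrightarrow> tagged_in Z \<pi> \<Longrightarrow> radius_fine \<delta> \<pi> \<Longrightarrow>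
      norm (\<Sum>(t, I)\<in>\<pi>. clip E F I) < \<epsilon>"
proof -
  obtain S where S: "S \<in> divisions_of (interior E)"
    using divisions_of_interior_nonempty[OF E] by blast
  obtain \<delta> where \<delta>: "radius_gauge_on Z \<delta>"
    "\<And>\<pi>. hk_partition_in UNIV \<pi> \<Longrightarrow> tagged_in Z \<pi> \<Longrightarrow> radius_fine \<delta> \<pi> \<Longrightarrow>
      norm (\<Sum>(t, I)\<in>\<pi>. \<Sum>\<^sub>\<infinity>k\<in>overlap_indices S I. F (I \<inter> S k)) < \<epsilon>"
    using neg[unfolded hk_negligible_variation_def, rule_format, OF \<open>\<epsilon> > 0\<close>] S by blast
  show thesis
  proof (rule that[OF \<delta>(1)])
    fix \<pi> assume \<pi>: "hk_partition_in UNIV \<pi>" "tagged_in Z \<pi>" "radius_fine \<delta> \<pi>"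
    have "(\<Sum>(t, I)\<in>\<pi>. \<Sum>\<^sub>\<infinity>k\<in>overlap_indices S I. F (I \<inter> S k)) = (\<Sum>(t, I)\<in>\<pi>. clip E F I)"
      using \<pi>(1)
      by (intro sum.cong) (auto simp: hk_partition_in_def intro: infsum_division_eq_clip[OF F E S])
    with \<delta>(2)[OF \<pi>] show "norm (\<Sum>(t, I)\<in>\<pi>. clip E F I) < \<epsilon>"
      by simp
  qed
qed

text \<open>For a tagged division of \<open>J\<close>, the error of the Riemann sum of
  \<open>f0\<close> splits by the position of the tags. Interior tags are controlled by
  \<open>loc\<close>, boundary tags by \<open>neg\<close>, each within half of
  \<open>\<epsilon>\<close>.\<close>

lemma has_integral_of_local_conditions:
  fixes f :: "real^'m \<Rightarrow> 'x::banach"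
  assumes E: "E \<in> intervals_in UNIV" and F: "dunford_function E F"
    and loc: "\<And>\<epsilon>. \<epsilon> > 0 \<Longrightarrow> \<exists>\<delta>. radius_gauge_on (interior E) \<delta> \<and>
      (\<forall>\<pi>. hk_partition_in (interior E) \<pi> \<and> radius_fine \<delta> \<pi> \<longrightarrow>
        norm (\<Sum>(t, I)\<in>\<pi>. measure lebesgue I *\<^sub>R f t - F I) < \<epsilon>)"
    and neg: "hk_negligible_variation E F (E - interior E)"
    and J: "J \<in> intervals_in E"
  shows "(f has_integral F J) J"
proof -
  define f0 where "f0 x = (if x \<in> interior E then f x else 0)" for x
  obtain a b where ab: "J = cbox a b" "J \<subseteq> E"
    using J by (auto simp: intervals_in_iff)
  have add: "additive_interval_function E F"
    using F by (simp add: dunford_function_def)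
  have "(f0 has_integral F J) (cbox a b)"
    unfolding has_integral
  proof (intro allI impI)
    fix \<epsilon> :: real assume "\<epsilon> > 0"
    then have e2: "\<epsilon> / 2 > 0"
      by simp
    obtain \<delta>1 where \<delta>1: "radius_gauge_on (interior E) \<delta>1"
      "\<And>\<pi>. hk_partition_in (interior E) \<pi> \<Longrightarrow> radius_fine \<delta>1 \<pi> \<Longrightarrow>
        norm (\<Sum>(t, I)\<in>\<pi>. measure lebesgue I *\<^sub>R f t - F I) < \<epsilon> / 2"
      using loc[OF e2] by blast
    obtain \<delta>2 where \<delta>2: "radius_gauge_on (E - interior E) \<delta>2"
      "\<And>\<pi>. hk_partition_in UNIV \<pi> \<Longrightarrow> tagged_in (E - interior E) \<pi> \<Longrightarrow> radius_fine \<delta>2 \<pi> \<Longrightarrow>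
        norm (\<Sum>(t, I)\<in>\<pi>. clip E F I) < \<epsilon> / 2"
      using negligible_variation_sum_clip[OF E F neg e2] by metis
    \<comment> \<open>Intersecting with the interior makes the interior-tagged boxes a partition in
      the interior, as \<open>loc\<close> demands. The value \<open>UNIV\<close> completes
      \<open>\<gamma>\<close> to a gauge on the whole space; the tags in question all lie in
      \<open>E\<close>.\<close>
    define \<gamma> where "\<gamma> t = (if t \<in> interior E then max_ball t (\<delta>1 t) \<inter> interior E
        else if t \<in> E then max_ball t (\<delta>2 t) else UNIV)" for t
    have "gauge \<gamma>"
      using \<delta>1(1) \<delta>2(1)
      by (auto simp: gauge_def \<gamma>_def radius_gauge_on_def open_max_ball centre_in_max_ball open_Int)
    moreover have "norm ((\<Sum>(x, K)\<in>p. measure lborel K *\<^sub>R f0 x) - F J) < \<epsilon>"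
      if p: "p tagged_division_of cbox a b" "\<gamma> fine p" for p
    proof -
      define q where "q = {(t, K) \<in> p. interior K \<noteq> {}}"
      define q1 where "q1 = {(t, K) \<in> q. t \<in> interior E}"
      define q2 where "q2 = {(t, K) \<in> q. t \<notin> interior E}"
      have pp: "p tagged_partial_division_of cbox a b"
        using p(1) by (simp add: tagged_division_of_def)
      have q: "hk_partition_in E q"
        using tagged_partial_division_imp_hk_partition_in[OF pp] ab hk_partition_in_superset
        unfolding q_def by blast
      have fine: "K \<subseteq> \<gamma> t" if "(t, K) \<in> q" for t K
        using p(2) that by (auto simp: fine_def q_def)
      have tag: "t \<in> E" "K \<in> intervals_in E" if "(t, K) \<in> q" for t K
        using q that by (auto simp: hk_partition_in_def intervals_in_iff)
      have q12: "hk_partition_in E q1" "hk_partition_in E q2"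
        using q by (rule hk_partition_in_subset; force simp: q1_def q2_def)+
      have fin: "finite p" "finite q1" "finite q2"
        using q12 pp by (auto simp: hk_partition_in_def tagged_partial_division_of_def)
      have "K \<subseteq> interior E" if "(t, K) \<in> q1" for t K
        using fine that by (force simp: q1_def \<gamma>_def)
      then have "hk_partition_in (interior E) q1"
        using q12(1) by (fastforce simp: hk_partition_in_def intervals_in_iff)
      moreover have "radius_fine \<delta>1 q1"
        using fine by (fastforce simp: radius_fine_def q1_def \<gamma>_def)
      ultimately have 1: "norm (\<Sum>(t, K)\<in>q1. measure lebesgue K *\<^sub>R f t - F K) < \<epsilon> / 2"
        by (rule \<delta>1(2))
      have "tagged_in (E - interior E) q2"
        using tag by (auto simp: tagged_in_def q2_def)
      moreover have "radius_fine \<delta>2 q2"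
        using fine tag by (fastforce simp: radius_fine_def q2_def \<gamma>_def)
      ultimately have 2: "norm (\<Sum>(t, K)\<in>q2. clip E F K) < \<epsilon> / 2"
        using q12(2) hk_partition_in_superset by (intro \<delta>2(2)) blast+
      \<comment> \<open>Writing \<open>F J\<close> as a sum over \<open>p\<close> turns the error
        into a sum of local terms, one for each box.\<close>
      have "clip E F (cbox a b) = F J"
        using clip_eq[OF J] ab by simp
      then have "(\<Sum>(x, K)\<in>p. measure lborel K *\<^sub>R f0 x) - F J
          = (\<Sum>(x, K)\<in>p. measure lborel K *\<^sub>R f0 x - clip E F K)"
        using sum_clip_tagged_division[OF E add p(1)] by (simp add: sum_subtractf split_def)
      \<comment> \<open>The boxes outside \<open>q\<close> are degenerate, and both their content
        and their \<open>clip\<close> value are 0.\<close>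
      also have "\<dots> = (\<Sum>(x, K)\<in>q. measure lborel K *\<^sub>R f0 x - clip E F K)"
      proof (rule sum.mono_neutral_right[OF fin(1)])
        show "\<forall>i\<in>p - q. (case i of (x, K) \<Rightarrow> measure lborel K *\<^sub>R f0 x - clip E F K) = 0"
        proof clarify
          fix t K assume *: "(t, K) \<in> p" "(t, K) \<notin> q"
          then have "interior K = {}"
            by (simp add: q_def)
          moreover obtain u v where "K = cbox u v"
            using pp * by (meson tagged_partial_division_ofD(4))
          ultimately have "measure lborel K = 0"
            by (simp add: content_eq_0_interior)
          then show "measure lborel K *\<^sub>R f0 t - clip E F K = 0"
            using clip_empty_interior[OF \<open>interior K = {}\<close>] by simp
        qed
      qed (auto simp: q_def)
      also have "q = q1 \<union> q2"
        by (auto simp: q1_def q2_def)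
      also have "(\<Sum>(x, K)\<in>q1 \<union> q2. measure lborel K *\<^sub>R f0 x - clip E F K)
          = (\<Sum>(x, K)\<in>q1. measure lborel K *\<^sub>R f0 x - clip E F K)
            + (\<Sum>(x, K)\<in>q2. measure lborel K *\<^sub>R f0 x - clip E F K)"
        using fin by (intro sum.union_disjoint) (auto simp: q1_def q2_def)
      also have "(\<Sum>(x, K)\<in>q1. measure lborel K *\<^sub>R f0 x - clip E F K)
          = (\<Sum>(t, K)\<in>q1. measure lebesgue K *\<^sub>R f t - F K)"
        by (intro sum.cong)
          (auto simp: q1_def f0_def clip_eq[OF tag(2)] measure_lebesgue_interval[OF tag(2)])
      also have "(\<Sum>(x, K)\<in>q2. measure lborel K *\<^sub>R f0 x - clip E F K) = - (\<Sum>(t, K)\<in>q2. clip E F K)"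
        unfolding sum_negf[symmetric] by (intro sum.cong) (auto simp: q2_def f0_def)
      finally show ?thesis
        using 1 2 norm_triangle_ineq4[of "\<Sum>(t, K)\<in>q1. measure lebesgue K *\<^sub>R f t - F K"
            "\<Sum>(t, K)\<in>q2. clip E F K"] by simp
    qed
    ultimately show "\<exists>\<gamma>. gauge \<gamma> \<and> (\<forall>p. p tagged_division_of cbox a b \<and> \<gamma> fine p \<longrightarrow>
        norm ((\<Sum>(x, K)\<in>p. measure lborel K *\<^sub>R f0 x) - F J) < \<epsilon>)"
      by (intro exI[of _ \<gamma>]) simp
  qed
  then have "(f0 has_integral F J) J"
    by (simp only: ab(1))
  moreover have "f x = f0 x" if "x \<in> interior E" for x
    using that by (simp add: f0_def)
  ultimately show ?thesis
    using has_integral_interval_spike_boundary[OF J, where f = f0 and g = f] by blast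
qed

theorem theorem3p8:
  fixes I\<^sub>0 :: "(real^'m::finite) set"
    and f :: "real^'m \<Rightarrow> 'x::banach"
    and F :: "(real^'m) set \<Rightarrow> 'x"
  assumes "I\<^sub>0 \<in> intervals_in UNIV"
    and "dunford_function I\<^sub>0 F"
  shows "hk_integrable_with_primitive I\<^sub>0 f F \<longleftrightarrow>
    (\<forall>\<epsilon>>0. \<exists>\<delta>. radius_gauge_on (interior I\<^sub>0) \<delta> \<and>
      (\<forall>\<pi>. hk_partition_in (interior I\<^sub>0) \<pi> \<and> radius_fine \<delta> \<pi> \<longrightarrow>
        norm (\<Sum>(t, I)\<in>\<pi>. measure lebesgue I *\<^sub>R f t - F I) < \<epsilon>)) \<and>
    hk_negligible_variation I\<^sub>0 F (I\<^sub>0 - interior I\<^sub>0)"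
    (is "_ \<longleftrightarrow> ?loc \<and> ?neg")
proof
  assume "hk_integrable_with_primitive I\<^sub>0 f F"
  then have f: "(f has_integral F I) I" if "I \<in> intervals_in I\<^sub>0" for I
    using that by (simp add: hk_primitive_iff[OF assms(1)])
  have ?loc
  proof (intro allI impI)
    fix \<epsilon> :: real assume "\<epsilon> > 0"
    obtain \<delta> where \<delta>: "\<And>t. 0 < \<delta> t"
      "\<And>\<pi>. hk_partition_in I\<^sub>0 \<pi> \<Longrightarrow> radius_fine \<delta> \<pi> \<Longrightarrow>
        norm (\<Sum>(t, I)\<in>\<pi>. measure lebesgue I *\<^sub>R f t - F I) < \<epsilon>"
      using Saks_Henstock_radius_gauge[OF assms(1) f \<open>\<epsilon> > 0\<close>] by blast
    have "radius_gauge_on (interior I\<^sub>0) \<delta>"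
      using \<delta>(1) by (simp add: radius_gauge_on_def)
    then show "\<exists>\<delta>. radius_gauge_on (interior I\<^sub>0) \<delta> \<and>
      (\<forall>\<pi>. hk_partition_in (interior I\<^sub>0) \<pi> \<and> radius_fine \<delta> \<pi> \<longrightarrow>
        norm (\<Sum>(t, I)\<in>\<pi>. measure lebesgue I *\<^sub>R f t - F I) < \<epsilon>)"
      \<comment> \<open>A partition in the interior is also one in the whole interval, so the same
        gauge serves.\<close>
      using \<delta>(2)[OF hk_partition_in_superset[OF _ interior_subset]] by (intro exI[of _ \<delta>]) blast
  qed
  moreover have ?neg
    using negligible_variation_of_primitive[OF assms f] .
  ultimately show "?loc \<and> ?neg"
    by blast
next
  assume *: "?loc \<and> ?neg"
  then have loc: ?loc and neg: ?neg
    by blast+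
  show "hk_integrable_with_primitive I\<^sub>0 f F"
    unfolding hk_primitive_iff[OF assms(1)]
    using has_integral_of_local_conditions[OF assms _ neg] loc by simp
qed

end
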